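(* Let $\mathcal{G}(\mathcal{V},\mathcal{E})$ be the two-layer IDNC conflict graph of an instance with users $\mathcal{N}=\{1,\dots,N\}$, packets $\mathcal{M}=\{1,\dots,M\}$, D2D connection matrix $\mathbf{C}$, Has sets $\mathcal{H}_n$ and Wants sets $\mathcal{W}_n$. Then choosing users that transmit coded packets over the D2D links, together with coded packets that can be broadcast simultaneously over the cellular and D2D links, is equivalent to choosing an independent set of $\mathcal{G}$. That is, the map sending a one-slot strategy $(P_{\mathrm{BS}},(P_i)_{i\in\mathcal{N}})$ to the vertex set $$\{v_l^{(\mathrm{BS})} : l\in P_{\mathrm{BS}}\}\cup\{v_l^{(i)} : i\in\mathcal{N},\ l\in P_i\}\subseteq\mathcal{V}$$ restricts to a bijection between the efficient instantly decodable strategies and the independent sets of $\mathcal{G}$.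
   Context: Setting. There are one base station (BS), users $\mathcal{N}=\{1,\dots,N\}$ and packets $\mathcal{M}=\{1,\dots,M\}$ (packet $l$ is also written $p_l$). For each user $n$, $\mathcal{M}$ is the disjoint union of the Has set $\mathcal{H}_n$ (packets held by $n$) and the Wants set $\mathcal{W}_n$ (packets missing at $n$). The D2D network is given by a symmetric matrix $\mathbf{C}=(c_{jk})\in\{0,1\}^{N\times N}$ with zero diagonal, where $c_{jk}=1$ iff users $j,k$ are directly connected by a single-hop D2D link. The coverage area of user $j$ is $\mathcal{Y}_j=\{k\in\mathcal{N}: c_{jk}=1\}$ (possibly empty). One-slot strategy. In one slot the BS sends to all users over the cellular link the XOR of a set $P_{\mathrm{BS}}\subseteq\bigcup_{n}\mathcal{W}_n$ of packets, and each user $i$ sends to all users of $\mathcal{Y}_i$ over D2D links the XOR of a set $P_i$ of packets, with $P_i\subseteq\{l\in\mathcal{H}_i : l\in\mathcal{W}_k\text{ for some }k\in\mathcal{Y}_i\}$. An empty set means no transmission; users with $P_i\neq\emptyset$ are the transmitting (scheduled) users. Cellular and D2D transmissions use different frequencies and do not interfere. The strategy is an efficient instantly decodable (IDNC) strategy if none of the following occurs: (i) transmission inadmissibility: a coded packet received by a user contains at least two source packets of that user's Wants set, i.e. $|P_{\mathrm{BS}}\cap\mathcal{W}_k|\ge 2$ for some $k\in\mathcal{N}$, or $|P_i\cap\mathcal{W}_k|\ge2$ for some $i$ and some $k\in\mathcal{Y}_i$; (ii) conflict: two transmitting users $i\ne j$ with $c_{ij}=1$; (iii) congestion: two transmitting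 users $i\neq j$ with $\mathcal{Y}_i\cap\mathcal{Y}_j\ne\emptyset$; (iv) redundancy: the same packet is sent over both the cellular and the D2D links, i.e. $P_{\mathrm{BS}}\cap P_i\neq\emptyset$ for some $i$. Conflict graphs (all undirected). Higher-layer graph $\mathcal{G}_1(\mathcal{V}_1,\mathcal{E}_1)$: one vertex $v_l^{(\mathrm{BS})}$ for each $l\in\bigcup_n\mathcal{W}_n$; distinct $v_n^{(\mathrm{BS})},v_l^{(\mathrm{BS})}$ are adjacent iff some user $k$ has both $n,l\in\mathcal{W}_k$. Lower-layer graph $\mathcal{G}_2(\mathcal{V}_2,\mathcal{E}_2)$: a vertex $v_l^{(i)}$ for each user $i$ and packet $l\in\mathcal{H}_i$ such that $l\in\mathcal{W}_k$ for some $k\in\mathcal{Y}_i$; two distinct vertices $v_l^{(i)},v_m^{(j)}$ are adjacent iff at least one holds: (C1) $i=j$, $l\ne m$, and some $k\in\mathcal{Y}_i$ has $l,m\in\mathcal{W}_k$; (C2) $i\neq j$ and some third user lies in $\mathcal{Y}_i\cap\mathcal{Y}_j$; (C3) $i\ne j$ and $c_{ij}=1$. Two-layer graph $\mathcal{G}(\mathcal{V},\mathcal{E})$: $\mathcal{V}=\mathcal{V}_1\cup\mathcal{V}_2$ (disjoint), with the edges of $\mathcal{E}_1$ and $\mathcal{E}_2$ together with an edge between $v_l^{(\mathrm{BS})}$ and $v_l^{(i)}$ whenever both are vertices (same packet). *)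

theory Defs
  imports "HOL-Library.Ramsey"
begin

locale idnc_instance =
  fixes N M :: nat
    and c :: "nat \<Rightarrow> nat \<Rightarrow> nat"
    and H W :: "nat \<Rightarrow> nat set"
  assumes packets_split: "n \<in> {1..N} \<Longrightarrow> H n \<union> W n = {1..M}"
    and packets_disjoint: "n \<in> {1..N} \<Longrightarrow> H n \<inter> W n = {}"
    and conn_binary: "j \<in> {1..N} \<Longrightarrow> k \<in> {1..N} \<Longrightarrow> c j k \<in> {0, 1}"
    and conn_sym: "j \<in> {1..N} \<Longrightarrow> k \<in> {1..N} \<Longrightarrow> c j k = c k j"
    and conn_diag: "j \<in> {1..N} \<Longrightarrow> c j j = 0"

definition coverage :: "nat \<Rightarrow> (nat \<Rightarrow> nat \<Rightarrow> nat) \<Rightarrow> nat \<Rightarrow> nat set" where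
  "coverage N c j = {k \<in> {1..N}. c j k = 1}"

definition wanted :: "nat \<Rightarrow> (nat \<Rightarrow> nat set) \<Rightarrow> nat set" where
  "wanted N W = (\<Union>n\<in>{1..N}. W n)"

definition sendable ::
  "nat \<Rightarrow> (nat \<Rightarrow> nat \<Rightarrow> nat) \<Rightarrow> (nat \<Rightarrow> nat set) \<Rightarrow> (nat \<Rightarrow> nat set) \<Rightarrow> nat \<Rightarrow> nat set" where
  "sendable N c H W i = {l \<in> H i. \<exists>k\<in>coverage N c i. l \<in> W k}"


text \<open>A strategy is a pair of the packet set of the base station and the family of packet sets of
  the users. The family is extensional, so that only its values on the users matter for equality
  of strategies.\<close>

type_synonym strategy = "nat set \<times> (nat \<Rightarrow> nat set)"

definition strategies ::
  "nat \<Rightarrow> (nat \<Rightarrow> nat \<Rightarrow> nat) \<Rightarrow> (nat \<Rightarrow> nat set) \<Rightarrow> (nat \<Rightarrow> nat set) \<Rightarrow> strategy set" where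
  "strategies N c H W =
     Pow (wanted N W) \<times> (\<Pi>\<^sub>E i\<in>{1..N}. Pow (sendable N c H W i))"

definition transmitting :: "nat \<Rightarrow> (nat \<Rightarrow> nat set) \<Rightarrow> nat set" where
  "transmitting N P = {i \<in> {1..N}. P i \<noteq> {}}"

definition inadmissible ::
  "nat \<Rightarrow> (nat \<Rightarrow> nat \<Rightarrow> nat) \<Rightarrow> (nat \<Rightarrow> nat set) \<Rightarrow> strategy \<Rightarrow> bool" where
  "inadmissible N c W = (\<lambda>(PBS, P).
     (\<exists>k\<in>{1..N}. card (PBS \<inter> W k) \<ge> 2) \<or>
     (\<exists>i\<in>{1..N}. \<exists>k\<in>coverage N c i. card (P i \<inter> W k) \<ge> 2))"

definition conflict :: "nat \<Rightarrow> (nat \<Rightarrow> nat \<Rightarrow> nat) \<Rightarrow> strategy \<Rightarrow> bool" where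
  "conflict N c = (\<lambda>(PBS, P).
     \<exists>i\<in>transmitting N P. \<exists>j\<in>transmitting N P. i \<noteq> j \<and> c i j = 1)"

definition congestion :: "nat \<Rightarrow> (nat \<Rightarrow> nat \<Rightarrow> nat) \<Rightarrow> strategy \<Rightarrow> bool" where
  "congestion N c = (\<lambda>(PBS, P).
     \<exists>i\<in>transmitting N P. \<exists>j\<in>transmitting N P.
       i \<noteq> j \<and> coverage N c i \<inter> coverage N c j \<noteq> {})"

definition redundancy :: "nat \<Rightarrow> strategy \<Rightarrow> bool" where
  "redundancy N = (\<lambda>(PBS, P). \<exists>i\<in>{1..N}. PBS \<inter> P i \<noteq> {})"

definition efficient_idnc ::
  "nat \<Rightarrow> (nat \<Rightarrow> nat \<Rightarrow> nat) \<Rightarrow> (nat \<Rightarrow> nat set) \<Rightarrow> strategy \<Rightarrow> bool" where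
  "efficient_idnc N c W s \<longleftrightarrow>
     \<not> inadmissible N c W s \<and> \<not> conflict N c s \<and> \<not> congestion N c s \<and> \<not> redundancy N s"


text \<open>\<open>BS l\<close> is the vertex of packet \<open>l\<close> at the base station, \<open>Usr i l\<close> that of packet \<open>l\<close> at
  user \<open>i\<close>. Edges are two-element vertex sets, as for \<^const>\<open>indep\<close>.\<close>

datatype vertex = BS nat | Usr nat nat

definition vertices1 :: "nat \<Rightarrow> (nat \<Rightarrow> nat set) \<Rightarrow> vertex set" where
  "vertices1 N W = BS ` wanted N W"

definition edges1 :: "nat \<Rightarrow> (nat \<Rightarrow> nat set) \<Rightarrow> vertex set set" where
  "edges1 N W = {{BS n, BS l} | n l.
     BS n \<in> vertices1 N W \<and> BS l \<in> vertices1 N W \<and> n \<noteq> l \<and>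
     (\<exists>k\<in>{1..N}. n \<in> W k \<and> l \<in> W k)}"

definition vertices2 ::
  "nat \<Rightarrow> (nat \<Rightarrow> nat \<Rightarrow> nat) \<Rightarrow> (nat \<Rightarrow> nat set) \<Rightarrow> (nat \<Rightarrow> nat set) \<Rightarrow> vertex set" where
  "vertices2 N c H W = {Usr i l | i l. i \<in> {1..N} \<and> l \<in> sendable N c H W i}"

definition edges2 ::
  "nat \<Rightarrow> (nat \<Rightarrow> nat \<Rightarrow> nat) \<Rightarrow> (nat \<Rightarrow> nat set) \<Rightarrow> (nat \<Rightarrow> nat set) \<Rightarrow> vertex set set" where
  "edges2 N c H W = {{Usr i l, Usr j m} | i l j m.
     Usr i l \<in> vertices2 N c H W \<and> Usr j m \<in> vertices2 N c H W \<and>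
     ((i = j \<and> l \<noteq> m \<and> (\<exists>k\<in>coverage N c i. l \<in> W k \<and> m \<in> W k)) \<or>
      (i \<noteq> j \<and> (\<exists>k. k \<noteq> i \<and> k \<noteq> j \<and> k \<in> coverage N c i \<inter> coverage N c j)) \<or>
      (i \<noteq> j \<and> c i j = 1))}"

definition vertices ::
  "nat \<Rightarrow> (nat \<Rightarrow> nat \<Rightarrow> nat) \<Rightarrow> (nat \<Rightarrow> nat set) \<Rightarrow> (nat \<Rightarrow> nat set) \<Rightarrow> vertex set" where
  "vertices N c H W = vertices1 N W \<union> vertices2 N c H W"

definition edges ::
  "nat \<Rightarrow> (nat \<Rightarrow> nat \<Rightarrow> nat) \<Rightarrow> (nat \<Rightarrow> nat set) \<Rightarrow> (nat \<Rightarrow> nat set) \<Rightarrow> vertex set set" where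
  "edges N c H W = edges1 N W \<union> edges2 N c H W \<union>
     {{BS l, Usr i l} | l i. BS l \<in> vertices1 N W \<and> Usr i l \<in> vertices2 N c H W}"

definition independent_set :: "'v set \<Rightarrow> 'v set set \<Rightarrow> 'v set \<Rightarrow> bool" where
  "independent_set V E S \<longleftrightarrow> S \<subseteq> V \<and> indep S E"

definition strategy_vertices :: "nat \<Rightarrow> strategy \<Rightarrow> vertex set" where
  "strategy_vertices N = (\<lambda>(PBS, P).
     {BS l | l. l \<in> PBS} \<union> {Usr i l | i l. i \<in> {1..N} \<and> l \<in> P i})"

end

theory Submission
  imports Defs
begin

text \<open>Every vertex set comes from exactly one strategy. The four ways in which a strategy can fail
  to be efficient correspond to the edges of the graph: inadmissibility to the edges of the higher
  layer and to (C1), conflict to (C3), congestion to (C2) and redundancy to the edges between the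
  layers. In (C2) the third user may be any common neighbour, as no user covers itself.\<close>

text \<open>Inadmissibility counts packets, whereas edges speak of pairs of distinct packets; this
  translates the one into the other. Finiteness matters, as \<open>card\<close> is 0 on infinite
  sets.\<close>

lemma two_le_card_iff:
  assumes "finite A"
  shows "2 \<le> card A \<longleftrightarrow> (\<exists>x\<in>A. \<exists>y\<in>A. x \<noteq> y)"
  using card_le_Suc0_iff_eq[OF assms] by (auto simp: not_less_eq_eq[symmetric] numeral_2_eq_2)

lemma BS_mem_strategy_vertices [simp]: "BS l \<in> strategy_vertices N (PBS, P) \<longleftrightarrow> l \<in> PBS"
  by (simp add: strategy_vertices_def)

lemma Usr_mem_strategy_vertices [simp]:
  "Usr i l \<in> strategy_vertices N (PBS, P) \<longleftrightarrow> i \<in> {1..N} \<and> l \<in> P i"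
  by (simp add: strategy_vertices_def)

lemma BS_mem_vertices [simp]: "BS l \<in> vertices N c H W \<longleftrightarrow> l \<in> wanted N W"
  by (auto simp: vertices_def vertices1_def vertices2_def)

lemma Usr_mem_vertices [simp]:
  "Usr i l \<in> vertices N c H W \<longleftrightarrow> i \<in> {1..N} \<and> l \<in> sendable N c H W i"
  by (auto simp: vertices_def vertices1_def vertices2_def)

lemma bij_betw_strategy_vertices:
  "bij_betw (strategy_vertices N) (strategies N c H W) (Pow (vertices N c H W))"
proof (rule bij_betw_byWitness)
  \<comment> \<open>The inverse sorts the vertices by sender. Restricting the family to
    \<open>{1..N}\<close> makes it extensional, so the strategy itself is recovered and not just its
    values on the users.\<close>
  let ?inv = "\<lambda>S. ({l. BS l \<in> S}, \<lambda>i\<in>{1..N}. {l. Usr i l \<in> S})"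
  show "\<forall>s\<in>strategies N c H W. ?inv (strategy_vertices N s) = s"
    by (auto simp: strategies_def PiE_def extensional_def fun_eq_iff)
  show "\<forall>S\<in>Pow (vertices N c H W). strategy_vertices N (?inv S) = S"
  proof (intro ballI set_eqI)
    fix S v
    assume "S \<in> Pow (vertices N c H W)"
    \<comment> \<open>A user index out of range would be lost by \<open>?inv\<close>; the vertices
      of the graph have none.\<close>
    then have "i \<in> {1..N}" if "Usr i l \<in> S" for i l
      using that Usr_mem_vertices by blast
    then show "v \<in> strategy_vertices N (?inv S) \<longleftrightarrow> v \<in> S"
      by (cases v) auto
  qed
  show "strategy_vertices N ` strategies N c H W \<subseteq> Pow (vertices N c H W)"
  proof clarify
    fix PBS P v
    assume "(PBS, P) \<in> strategies N c H W" "v \<in> strategy_vertices N (PBS, P)"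
    then show "v \<in> vertices N c H W"
      by (cases v) (auto simp: strategies_def PiE_def Pi_def)
  qed
  show "?inv ` Pow (vertices N c H W) \<subseteq> strategies N c H W"
    by (auto simp: strategies_def dest: subsetD[where c = "BS _"] subsetD[where c = "Usr _ _"])
qed

text \<open>Only the higher layer joins two base station vertices. A user wanting both packets
  already makes both of them vertices.\<close>

lemma BS_BS_mem_edges:
  "{BS n, BS l} \<in> edges N c H W \<longleftrightarrow>
    n \<noteq> l \<and> (\<exists>k\<in>{1..N}. n \<in> W k \<and> l \<in> W k)"
  unfolding edges_def edges1_def edges2_def vertices1_def wanted_def
  by (auto simp: doubleton_eq_iff)

lemma BS_Usr_mem_edges:
  "{BS n, Usr i l} \<in> edges N c H W \<longleftrightarrow>
    n = l \<and> l \<in> wanted N W \<and> i \<in> {1..N} \<and> l \<in> sendable N c H W i"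
  unfolding edges_def edges1_def edges2_def vertices1_def vertices2_def
  by (auto simp: doubleton_eq_iff)

context idnc_instance
begin

lemma coverage_not_self: "i \<in> {1..N} \<Longrightarrow> i \<notin> coverage N c i"
  using conn_diag by (simp add: coverage_def)

lemma finite_Wants: "k \<in> {1..N} \<Longrightarrow> finite (W k)"
  using packets_split[of k] by (metis finite_Un finite_atLeastAtMost)

lemma Usr_Usr_mem_edges:
  assumes "i \<in> {1..N}" "l \<in> sendable N c H W i" "j \<in> {1..N}" "m \<in> sendable N c H W j"
  shows "{Usr i l, Usr j m} \<in> edges N c H W \<longleftrightarrow>
    (if i = j then l \<noteq> m \<and> (\<exists>k\<in>coverage N c i. l \<in> W k \<and> m \<in> W k)
     else coverage N c i \<inter> coverage N c j \<noteq> {} \<or> c i j = 1)" (is "_ \<longleftrightarrow> ?adj")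
proof -
  \<comment> \<open>Edges are unordered, so membership of a doubleton yields the adjacency condition
    for either order of its ends. Naming the condition allows the two orders to be compared: they
    agree because \<open>c\<close> is symmetric.\<close>
  define E where "E i l j m \<longleftrightarrow>
    (i = j \<and> l \<noteq> m \<and> (\<exists>k\<in>coverage N c i. l \<in> W k \<and> m \<in> W k)) \<or>
    (i \<noteq> j \<and> (\<exists>k. k \<noteq> i \<and> k \<noteq> j \<and> k \<in> coverage N c i \<inter> coverage N c j)) \<or>
    (i \<noteq> j \<and> c i j = 1)" for i l j m
  have edges2_eq: "edges2 N c H W = {{Usr i l, Usr j m} | i l j m.
      Usr i l \<in> vertices2 N c H W \<and> Usr j m \<in> vertices2 N c H W \<and> E i l j m}"
    unfolding edges2_def E_def ..
  have "{Usr i l, Usr j m} \<in> edges N c H W \<longleftrightarrow> {Usr i l, Usr j m} \<in> edges2 N c H W"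
    by (auto simp: edges_def edges1_def doubleton_eq_iff)
  also have "\<dots> \<longleftrightarrow> E i l j m \<or> E j m i l"
    using assms unfolding edges2_eq vertices2_def by (auto simp: doubleton_eq_iff)
  also have "E j m i l \<longleftrightarrow> E i l j m"
    using conn_sym[OF assms(1,3)] unfolding E_def by auto
  also have "E i l j m \<or> E i l j m \<longleftrightarrow> ?adj"
    using coverage_not_self[OF assms(1)] coverage_not_self[OF assms(3)]
    unfolding E_def by (cases "i = j") auto
  finally show ?thesis .
qed

lemma efficient_idnc_iff_indep:
  assumes "s \<in> strategies N c H W"
  shows "efficient_idnc N c W s \<longleftrightarrow> indep (strategy_vertices N s) (edges N c H W)"
proof -
  obtain PBS P where s: "s = (PBS, P)"
    by fastforce
  \<comment> \<open>Packets chosen by a strategy always give vertices, which discharges the vertex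
    conditions in the edge characterizations.\<close>
  have PBS: "l \<in> wanted N W" if "l \<in> PBS" for l
    using assms that by (auto simp: s strategies_def)
  have P: "l \<in> sendable N c H W i" if "i \<in> {1..N}" "l \<in> P i" for i l
    using assms that by (auto simp: s strategies_def PiE_def Pi_def)
  define e where "e = edges N c H W"
  have all_vertex: "(\<forall>v\<in>strategy_vertices N s. Q v) \<longleftrightarrow>
    (\<forall>l\<in>PBS. Q (BS l)) \<and> (\<forall>i\<in>{1..N}. \<forall>l\<in>P i. Q (Usr i l))" for Q
    by (auto simp: s strategy_vertices_def)
  \<comment> \<open>Independence is split by the kind of pair: both at the base station, mixed, same
    user, different users. Mixed pairs occur in both orders and are merged by
    \<open>insert_commute\<close>.\<close>
  have "indep (strategy_vertices N s) e \<longleftrightarrow>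
    (\<forall>n\<in>PBS. \<forall>l\<in>PBS. n \<noteq> l \<longrightarrow> {BS n, BS l} \<notin> e) \<and>
    (\<forall>n\<in>PBS. \<forall>i\<in>{1..N}. \<forall>l\<in>P i. {BS n, Usr i l} \<notin> e) \<and>
    (\<forall>i\<in>{1..N}. \<forall>l\<in>P i. \<forall>m\<in>P i. l \<noteq> m \<longrightarrow> {Usr i l, Usr i m} \<notin> e) \<and>
    (\<forall>i\<in>{1..N}. \<forall>j\<in>{1..N}. i \<noteq> j \<longrightarrow> (\<forall>l\<in>P i. \<forall>m\<in>P j. {Usr i l, Usr j m} \<notin> e))"
    unfolding indep_def all_vertex
    apply (auto simp: insert_commute[of "Usr _ _" "BS _"])
    subgoal for i l j m by (cases "i = j") auto
    done
  moreover have "(\<forall>n\<in>PBS. \<forall>l\<in>PBS. n \<noteq> l \<longrightarrow> {BS n, BS l} \<notin> e) \<longleftrightarrow>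
    \<not> (\<exists>k\<in>{1..N}. card (PBS \<inter> W k) \<ge> 2)"
    unfolding e_def BS_BS_mem_edges using finite_Wants
    by (simp add: two_le_card_iff) blast
  moreover have "(\<forall>n\<in>PBS. \<forall>i\<in>{1..N}. \<forall>l\<in>P i. {BS n, Usr i l} \<notin> e) \<longleftrightarrow>
    \<not> redundancy N s"
    unfolding e_def BS_Usr_mem_edges using PBS P by (simp add: s redundancy_def) blast
  moreover have
    "(\<forall>i\<in>{1..N}. \<forall>l\<in>P i. \<forall>m\<in>P i. l \<noteq> m \<longrightarrow> {Usr i l, Usr i m} \<notin> e) \<longleftrightarrow>
    \<not> (\<exists>i\<in>{1..N}. \<exists>k\<in>coverage N c i. card (P i \<inter> W k) \<ge> 2)" (is "?lhs \<longleftrightarrow> ?rhs")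
  proof -
    have "{Usr i l, Usr i m} \<in> e \<longleftrightarrow>
        l \<noteq> m \<and> (\<exists>k\<in>coverage N c i. l \<in> W k \<and> m \<in> W k)"
      if "i \<in> {1..N}" "l \<in> P i" "m \<in> P i" for i l m
      using that P by (simp add: e_def Usr_Usr_mem_edges)
    then have "?lhs \<longleftrightarrow> (\<forall>i\<in>{1..N}. \<forall>l\<in>P i. \<forall>m\<in>P i. l \<noteq> m \<longrightarrow>
        \<not> (\<exists>k\<in>coverage N c i. l \<in> W k \<and> m \<in> W k))"
      by (intro ball_cong refl) auto
    \<comment> \<open>The receiver \<open>k\<close> is moved outside the pair of packets, so that
      the pair lies in the fixed set \<open>P i \<inter> W k\<close>, whose cardinality is then
      compared with 2.\<close>
    also have "\<dots> \<longleftrightarrow>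
        \<not> (\<exists>i\<in>{1..N}. \<exists>k\<in>coverage N c i. \<exists>l\<in>P i \<inter> W k. \<exists>m\<in>P i \<inter> W k. l \<noteq> m)"
      by blast
    also have "\<dots> \<longleftrightarrow> ?rhs"
      using finite_Wants
      by (intro arg_cong[where f = Not] bex_cong refl) (simp add: two_le_card_iff coverage_def)
    finally show ?thesis .
  qed
  moreover have
    "(\<forall>i\<in>{1..N}. \<forall>j\<in>{1..N}. i \<noteq> j \<longrightarrow> (\<forall>l\<in>P i. \<forall>m\<in>P j. {Usr i l, Usr j m} \<notin> e)) \<longleftrightarrow>
    \<not> conflict N c s \<and> \<not> congestion N c s" (is "?lhs \<longleftrightarrow> ?rhs")
  proof -
    have "{Usr i l, Usr j m} \<in> e \<longleftrightarrow> coverage N c i \<inter> coverage N c j \<noteq> {} \<or> c i j = 1"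
      if "i \<in> {1..N}" "j \<in> {1..N}" "i \<noteq> j" "l \<in> P i" "m \<in> P j" for i j l m
      using that P by (simp add: e_def Usr_Usr_mem_edges)
    then have "?lhs \<longleftrightarrow> (\<forall>i\<in>{1..N}. \<forall>j\<in>{1..N}. i \<noteq> j \<longrightarrow> (\<forall>l\<in>P i. \<forall>m\<in>P j.
        \<not> (coverage N c i \<inter> coverage N c j \<noteq> {} \<or> c i j = 1)))"
      by (intro ball_cong imp_cong refl) auto
    \<comment> \<open>The condition no longer mentions the packets \<open>l\<close> and
      \<open>m\<close>, so quantifying over them only says that \<open>P i\<close> and
      \<open>P j\<close> are nonempty, that is, that both users transmit.\<close>
    also have "\<dots> \<longleftrightarrow> (\<forall>i\<in>transmitting N P. \<forall>j\<in>transmitting N P. i \<noteq> j \<longrightarrow>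
        \<not> (coverage N c i \<inter> coverage N c j \<noteq> {} \<or> c i j = 1))"
      by (auto simp: transmitting_def Ball_def ex_in_conv)
    also have "\<dots> \<longleftrightarrow> ?rhs"
      unfolding s conflict_def congestion_def by auto (metis disjoint_iff)
    finally show ?thesis .
  qed
  ultimately show ?thesis
    unfolding efficient_idnc_def inadmissible_def e_def by (auto simp: s)
qed

end

theorem theorem1:
  fixes N M :: nat
    and c :: "nat \<Rightarrow> nat \<Rightarrow> nat"
    and H W :: "nat \<Rightarrow> nat set"
  assumes "idnc_instance N M c H W"
  shows "strategy_vertices N \<in> strategies N c H W \<rightarrow> Pow (vertices N c H W) \<and>
    bij_betw (strategy_vertices N)
      {s \<in> strategies N c H W. efficient_idnc N c W s}
      {S. independent_set (vertices N c H W) (edges N c H W) S}"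
proof
  note bij = bij_betw_strategy_vertices[of N c H W]
  show "strategy_vertices N \<in> strategies N c H W \<rightarrow> Pow (vertices N c H W)"
    using bij by (rule bij_betw_imp_funcset)
  \<comment> \<open>The bijection onto all vertex sets restricts to the efficient strategies; it
    remains to identify their image. Efficiency of a strategy is independence of its vertex set, and
    every vertex set is attained.\<close>
  have "strategy_vertices N ` {s \<in> strategies N c H W. efficient_idnc N c W s} =
    {S \<in> strategy_vertices N ` strategies N c H W. indep S (edges N c H W)}"
    using idnc_instance.efficient_idnc_iff_indep[OF assms] by blast
  also have "\<dots> = {S. independent_set (vertices N c H W) (edges N c H W) S}"
    unfolding bij_betw_imp_surj_on[OF bij] independent_set_def by simp
  finally show "bij_betw (strategy_vertices N)
      {s \<in> strategies N c H W. efficient_idnc N c W s}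
      {S. independent_set (vertices N c H W) (edges N c H W) S}"
    by (rule bij_betw_subset[OF bij, rotated]) auto
qed

end
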